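(* Let $n\ge 1$ be an integer, let $Q_n(8,4)$ be the Möbius graph of the linear octagonal-quadrilateral network, built from $n$ octagons and $n$ quadrilaterals, and put $\mu=15+4\sqrt{14}$, $\nu=15-4\sqrt{14}$. Then $$Kf\big(Q_n(8,4)\big)=\frac{32n^3-2n}{3}+\frac{36n^2\sqrt{14}}{7}\left(\frac{\mu^n-\nu^n}{\mu^n+\nu^n+2}\right).$$
   Context: The graph $Q_n(8,4)$ is the simple undirected graph with $8n$ vertices $1,2,\dots,4n,1',2',\dots,(4n)'$ and the following $10n$ edges: the path edges $\{j,j+1\}$ and $\{j',(j+1)'\}$ for $1\le j\le 4n-1$; the rungs $\{j,j'\}$ for all $1\le j\le 4n$ with $j\equiv 0$ or $1 \pmod 4$; and the two twisted closing edges $\{4n,1'\}$ and $\{(4n)',1\}$. (It is obtained from the linear chain of alternating octagons and quadrilaterals, consecutive ones sharing an edge, by identifying the two opposite end edges in reversed order.) For a connected graph $G$, regard each edge as a unit resistor and let $r_{ij}$ be the resistance distance (effective resistance) between vertices $i$ and $j$. The Kirchhoff index is $Kf(G)=\sum_{i<j} r_{ij}$, the sum being over all unordered pairs of distinct vertices. *)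

theory Defs
  imports Complex_Main
begin

text \<open>
  A simple undirected graph is given by its vertex set \<open>V\<close> and its set \<open>E\<close> of edges, which are
  two-element subsets of \<open>V\<close>.
\<close>

text \<open>
  Every edge is a unit resistor, so by Ohm's law the current flowing from \<open>v\<close> to an adjacent
  vertex \<open>u\<close> is \<open>f v - f u\<close>. Kirchhoff's current law, with a unit current entering at \<open>i\<close> and
  leaving at \<open>j\<close>, determines the potential \<open>f\<close> on a finite connected graph up to an additive constant.
\<close>

definition unit_current_potential ::
    "'a set \<Rightarrow> 'a set set \<Rightarrow> 'a \<Rightarrow> 'a \<Rightarrow> ('a \<Rightarrow> real) \<Rightarrow> bool" where
  "unit_current_potential V E i j f \<longleftrightarrow>
     (\<forall>v\<in>V. (\<Sum>u | u \<in> V \<and> {v, u} \<in> E. f v - f u) = of_bool (v = i) - of_bool (v = j))"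

definition resistance_distance :: "'a set \<Rightarrow> 'a set set \<Rightarrow> 'a \<Rightarrow> 'a \<Rightarrow> real" where
  "resistance_distance V E i j =
     (THE r. \<exists>f. unit_current_potential V E i j f \<and> r = f i - f j)"

text \<open>The linear order only serves to list every unordered pair of distinct vertices once.\<close>

definition kirchhoff_index :: "'a::linorder set \<Rightarrow> 'a set set \<Rightarrow> real" where
  "kirchhoff_index V E =
     (\<Sum>(i, j) | i \<in> V \<and> j \<in> V \<and> i < j. resistance_distance V E i j)"

text \<open>
  The vertices \<open>1, \<dots>, 4n\<close> of \<open>Q\<^sub>n(8,4)\<close> are represented by themselves, and \<open>1', \<dots>, (4n)'\<close> by the
  numbers \<open>4n + 1, \<dots>, 8n\<close>.
\<close>

definition primed :: "nat \<Rightarrow> nat \<Rightarrow> nat" where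
  "primed n j = 4 * n + j"

definition Q_verts :: "nat \<Rightarrow> nat set" where
  "Q_verts n = {1..4 * n} \<union> primed n ` {1..4 * n}"

definition Q_edges :: "nat \<Rightarrow> nat set set" where
  "Q_edges n =
     {{j, j + 1} | j. 1 \<le> j \<and> j \<le> 4 * n - 1} \<union>
     {{primed n j, primed n (j + 1)} | j. 1 \<le> j \<and> j \<le> 4 * n - 1} \<union>
     {{j, primed n j} | j. 1 \<le> j \<and> j \<le> 4 * n \<and> (j mod 4 = 0 \<or> j mod 4 = 1)} \<union>
     {{4 * n, primed n 1}, {primed n (4 * n), 1}}"

end

theory Submission
  imports Defs
begin

text \<open>
  Suppose that \<open>G\<close> inverts the graph Laplacian up to constants: applying the Laplacian to the
  column \<open>G(\<cdot>, i)\<close> gives \<open>\<delta>\<^sub>i - 1/N\<close>, where \<open>N\<close> is the number of vertices. Then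
  \<open>G(\<cdot>, i) - G(\<cdot>, j)\<close> is a potential for a unit current from \<open>i\<close> to \<open>j\<close>, whence
  \<open>r\<^sub>i\<^sub>j = G(i,i) + G(j,j) - G(i,j) - G(j,i)\<close>, and summing over all pairs gives
  \<open>Kf = N tr G - \<Sum> G\<close> (lemma \<open>kirchhoff_index_eq_green\<close>). It remains to exhibit \<open>G\<close>.

  Put \<open>m = 4n\<close>. Because of the twist, the two paths and the two closing edges form one cycle of
  length \<open>2m\<close>, whose antipodal points \<open>j\<close> and \<open>j'\<close> are joined by a rung if \<open>j\<close> is \<open>0\<close> or \<open>1\<close>
  modulo \<open>4\<close>. The Laplacian commutes with the antipodal map \<open>j \<leftrightarrow> j'\<close>. On even functions, that is,
  \<open>m\<close>-periodic ones, no current flows through a rung, so it is the Laplacian of the \<open>m\<close>-cycle. On odd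
  functions, that is, \<open>m\<close>-antiperiodic ones, it is the operator
  \<open>x \<mapsto> p\<^sub>k x\<^sub>k - x\<^sub>k\<^sub>-\<^sub>1 - x\<^sub>k\<^sub>+\<^sub>1\<close>, with \<open>p\<^sub>k = 4\<close> at a rung and \<open>p\<^sub>k = 2\<close> elsewhere
  (lemma \<open>laplacian_lift\<close>). So \<open>G\<close> is assembled from the Green functions of these two operators.

  The cycle has a Green function that is quadratic in the distance; it vanishes on the diagonal, and
  its total sum produces the polynomial \<open>(32n\<^sup>3 - 2n)/3\<close>.

  In the odd part \<open>p\<close> has period \<open>4\<close>, and the transfer matrix over one period has determinant \<open>1\<close> and
  trace \<open>30\<close>, hence the eigenvalues \<open>\<mu>\<close> and \<open>\<nu>\<close>. Let \<open>u\<close> and \<open>w\<close> be the solutions of the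
  homogeneous recurrence that are multiplied by \<open>\<nu>\<close> and \<open>\<mu>\<close> over a period, and \<open>W\<close> their Wronskian.
  On the line, \<open>u(max(k,l)) w(min(k,l)) / W\<close> is a Green function, and summing its translates by multiples of
  \<open>m\<close> with alternating signs gives the antiperiodic one, whose diagonal is
  \<open>u(k) w(k) / W \<cdot> (1 - \<nu>\<^sup>n) / (1 + \<nu>\<^sup>n)\<close>. The product \<open>u(k) w(k)\<close> has period \<open>4\<close>, so the
  trace is \<open>n\<close> times a sum of four terms, and this gives the second summand of the formula.
\<close>

section \<open>Green functions\<close>

definition laplacian :: "'a set \<Rightarrow> 'a set set \<Rightarrow> ('a \<Rightarrow> real) \<Rightarrow> 'a \<Rightarrow> real" where
  "laplacian V E f v = (\<Sum>u | u \<in> V \<and> {v, u} \<in> E. f v - f u)"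

lemma laplacian_add: "laplacian V E (\<lambda>v. f v + g v) v = laplacian V E f v + laplacian V E g v"
  by (simp add: laplacian_def sum.distrib [symmetric] algebra_simps)

lemma laplacian_diff: "laplacian V E (\<lambda>v. f v - g v) v = laplacian V E f v - laplacian V E g v"
  by (simp add: laplacian_def sum_subtractf [symmetric] algebra_simps)

lemma laplacian_scale: "laplacian V E (\<lambda>v. c * f v) v = c * laplacian V E f v"
  by (simp add: laplacian_def sum_distrib_left algebra_simps)

lemma laplacian_self_adjoint:
  assumes "finite V"
  shows "(\<Sum>v\<in>V. laplacian V E f v * g v) = (\<Sum>v\<in>V. f v * laplacian V E g v)"
proof -
  have lap: "laplacian V E h v = (\<Sum>u\<in>V. of_bool ({v, u} \<in> E) * (h v - h u))" for h v
    unfolding laplacian_def using assms by (intro sum.mono_neutral_cong_left) auto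
  let ?w = "\<lambda>v u. of_bool ({v, u} \<in> E) * (f v * g u) :: real"
  have "(\<Sum>v\<in>V. laplacian V E f v * g v) - (\<Sum>v\<in>V. f v * laplacian V E g v)
      = (\<Sum>v\<in>V. \<Sum>u\<in>V. ?w v u - ?w u v)"
    unfolding lap sum_distrib_left sum_distrib_right sum_subtractf [symmetric]
    by (intro sum.cong refl) (simp add: algebra_simps insert_commute)
  also have "\<dots> = 0"
    using sum.swap [of "\<lambda>v u. ?w v u" V V] by (simp add: sum_subtractf)
  finally show ?thesis by simp
qed

definition green_function :: "'a set \<Rightarrow> 'a set set \<Rightarrow> ('a \<Rightarrow> 'a \<Rightarrow> real) \<Rightarrow> bool" where
  "green_function V E G \<longleftrightarrow>
     (\<forall>i\<in>V. \<forall>v\<in>V. laplacian V E (\<lambda>v. G v i) v = of_bool (v = i) - 1 / real (card V))"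

text \<open>
  Existence of a potential is immediate from \<open>G\<close>. Uniqueness of the potential drop comes from
  self-adjointness: pairing any potential \<open>f\<close> with the Laplacian of \<open>g = G(\<cdot>, i) - G(\<cdot>, j)\<close> yields
  \<open>f i - f j\<close>, while pairing \<open>g\<close> with the Laplacian of \<open>f\<close> yields \<open>g i - g j\<close>.
\<close>
lemma resistance_distance_eq_green:
  assumes "finite V" and G: "green_function V E G" and i: "i \<in> V" and j: "j \<in> V"
  shows "resistance_distance V E i j = G i i + G j j - G i j - G j i"
proof -
  let ?g = "\<lambda>v. G v i - G v j"
  have ucp: "unit_current_potential V E i j f \<longleftrightarrow>
      (\<forall>v\<in>V. laplacian V E f v = of_bool (v = i) - of_bool (v = j))" for f
    by (simp add: unit_current_potential_def laplacian_def)
  have g: "laplacian V E ?g v = of_bool (v = i) - of_bool (v = j)" if "v \<in> V" for v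
    using G i j that by (simp add: laplacian_diff green_function_def)
  have point: "(\<Sum>v\<in>V. h v * (of_bool (v = i) - of_bool (v = j))) = h i - h j" for h :: "'a \<Rightarrow> real"
    using assms by (simp add: algebra_simps sum_subtractf)
  have drop: "f i - f j = ?g i - ?g j" if f: "unit_current_potential V E i j f" for f
  proof -
    have "f i - f j = (\<Sum>v\<in>V. f v * laplacian V E ?g v)"
      using g by (simp add: point cong: sum.cong)
    also have "\<dots> = (\<Sum>v\<in>V. ?g v * laplacian V E f v)"
      using laplacian_self_adjoint [OF \<open>finite V\<close>, of E f ?g] by (simp add: mult.commute)
    also have "\<dots> = (\<Sum>v\<in>V. ?g v * (of_bool (v = i) - of_bool (v = j)))"
      using f by (intro sum.cong) (auto simp: ucp)
    also have "\<dots> = ?g i - ?g j"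
      by (rule point)
    finally show ?thesis .
  qed
  have "resistance_distance V E i j = ?g i - ?g j"
    unfolding resistance_distance_def using g ucp drop by (intro the_equality) blast+
  then show ?thesis by simp
qed

text \<open>
  The expression for \<open>r\<^sub>i\<^sub>j\<close> is symmetric in \<open>i\<close> and \<open>j\<close> and vanishes for \<open>i = j\<close>, so the sum over
  unordered pairs is half of the sum over all of \<open>V \<times> V\<close>.
\<close>
lemma kirchhoff_index_eq_green:
  fixes V :: "'a::linorder set"
  assumes fin: "finite V" and G: "green_function V E G"
  shows "kirchhoff_index V E
       = real (card V) * (\<Sum>v\<in>V. G v v) - (\<Sum>v\<in>V. \<Sum>i\<in>V. G v i)"
proof -
  let ?h = "\<lambda>i j. G i i + G j j - G i j - G j i"
  let ?lt = "{(i, j). i \<in> V \<and> j \<in> V \<and> i < j}"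
  let ?gt = "{(i, j). i \<in> V \<and> j \<in> V \<and> j < i}"
  have finite: "finite ?lt" "finite ?gt"
    by (rule finite_subset [of _ "V \<times> V"]; use fin in auto)+
  have kf: "kirchhoff_index V E = (\<Sum>(i, j)\<in>?lt. ?h i j)"
    unfolding kirchhoff_index_def
    by (intro sum.cong) (auto simp: resistance_distance_eq_green [OF fin G])
  have "(\<Sum>(i, j)\<in>?gt. ?h i j) = (\<Sum>(i, j)\<in>?lt. ?h i j)"
    by (rule sum.reindex_bij_witness [of _ prod.swap prod.swap]) auto
  then have "2 * kirchhoff_index V E = (\<Sum>(i, j)\<in>?lt. ?h i j) + (\<Sum>(i, j)\<in>?gt. ?h i j)"
    using kf by simp
  also have "\<dots> = (\<Sum>(i, j)\<in>?lt \<union> ?gt. ?h i j)"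
    using finite by (intro sum.union_disjoint [symmetric]) auto
  also have "\<dots> = (\<Sum>(i, j)\<in>V \<times> V. ?h i j)"
  proof (intro sum.mono_neutral_left ballI)
    fix x assume "x \<in> V \<times> V - (?lt \<union> ?gt)"
    then have "fst x = snd x" using linorder_less_linear by fastforce
    then show "(case x of (i, j) \<Rightarrow> ?h i j) = 0" by (cases x) simp
  qed (use fin in auto)
  also have "\<dots> = (\<Sum>i\<in>V. \<Sum>j\<in>V. ?h i j)"
    by (simp add: sum.cartesian_product)
  also have "\<dots> = 2 * real (card V) * (\<Sum>v\<in>V. G v v) - 2 * (\<Sum>v\<in>V. \<Sum>i\<in>V. G v i)"
    using sum.swap [of G V V]
    by (simp add: sum_subtractf sum.distrib flip: sum_distrib_left)
  finally show ?thesis by simp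
qed

section \<open>The graph as a double cover of a cycle\<close>

lemma Q_verts_eq: "Q_verts n = {1..2 * (4 * n)}"
proof -
  have "primed n ` {1..4 * n} = {4 * n + 1..4 * n + 4 * n}"
    using image_add_atLeastAtMost [of "4 * n" 1 "4 * n"] by (simp add: primed_def [abs_def])
  then show ?thesis by (auto simp: Q_verts_def)
qed

definition rung :: "nat \<Rightarrow> bool" where
  "rung k \<longleftrightarrow> k mod 4 = 0 \<or> k mod 4 = 1"

text \<open>
  In the numbering \<open>1, \<dots>, 8n\<close> the edges other than rungs join cyclically consecutive numbers, since
  \<open>1'\<close> is \<open>4n + 1\<close>; the rungs join numbers that differ by \<open>4n\<close>.
\<close>
lemma Q_neighbours:
  assumes "n \<ge> 1" and v: "v \<in> {1..2 * (4 * n)}"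
  shows "{u. u \<in> Q_verts n \<and> {v, u} \<in> Q_edges n} =
    {if v = 1 then 2 * (4 * n) else v - 1, if v = 2 * (4 * n) then 1 else v + 1} \<union>
    (if rung v then {if v \<le> 4 * n then v + 4 * n else v - 4 * n} else {})"
    (is "?L = ?R")
proof -
  have "u \<in> ?L \<longleftrightarrow> u \<in> ?R" for u
  proof -
    have path: "(\<exists>j. {v, u} = {j, j + 1} \<and> 1 \<le> j \<and> j \<le> 4 * n - 1) \<longleftrightarrow>
        (u = v + 1 \<and> v \<le> 4 * n - 1 \<or> v = u + 1 \<and> 1 \<le> u \<and> u \<le> 4 * n - 1)"
      using v by (auto simp: doubleton_eq_iff)
    have path': "(\<exists>j. {v, u} = {primed n j, primed n (j + 1)} \<and> 1 \<le> j \<and> j \<le> 4 * n - 1) \<longleftrightarrow>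
        (u = v + 1 \<and> 4 * n + 1 \<le> v \<and> v + 1 \<le> 2 * (4 * n) \<or>
         v = u + 1 \<and> 4 * n + 1 \<le> u \<and> u + 1 \<le> 2 * (4 * n))" (is "?P \<longleftrightarrow> ?Q")
    proof
      assume ?Q
      then show ?P
        by (elim disjE; intro exI [of _ "min u v - 4 * n"])
          (auto simp: doubleton_eq_iff primed_def)
    qed (auto simp: doubleton_eq_iff primed_def)
    have rungs: "(\<exists>j. {v, u} = {j, primed n j} \<and> 1 \<le> j \<and> j \<le> 4 * n \<and> (j mod 4 = 0 \<or> j mod 4 = 1)) \<longleftrightarrow>
        (rung v \<and> (v \<le> 4 * n \<and> u = v + 4 * n \<or> 4 * n < v \<and> v = u + 4 * n))" (is "?P \<longleftrightarrow> ?Q")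
    proof
      assume ?Q
      then show ?P
        using v by (elim conjE disjE; intro exI [of _ "min u v"])
          (auto simp: doubleton_eq_iff primed_def rung_def)
    qed (auto simp: doubleton_eq_iff primed_def rung_def)
    have ends: "{v, u} \<in> {{4 * n, primed n 1}, {primed n (4 * n), 1}} \<longleftrightarrow>
        (v = 4 * n \<and> u = 4 * n + 1 \<or> u = 4 * n \<and> v = 4 * n + 1 \<or>
         v = 2 * (4 * n) \<and> u = 1 \<or> u = 2 * (4 * n) \<and> v = 1)"
      by (auto simp: doubleton_eq_iff primed_def)
    have "u \<in> ?L \<longleftrightarrow> u \<in> {1..2 * (4 * n)} \<and>
      ((u = v + 1 \<and> v \<le> 4 * n - 1 \<or> v = u + 1 \<and> 1 \<le> u \<and> u \<le> 4 * n - 1) \<or>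
       (u = v + 1 \<and> 4 * n + 1 \<le> v \<and> v + 1 \<le> 2 * (4 * n) \<or>
         v = u + 1 \<and> 4 * n + 1 \<le> u \<and> u + 1 \<le> 2 * (4 * n)) \<or>
       (rung v \<and> (v \<le> 4 * n \<and> u = v + 4 * n \<or> 4 * n < v \<and> v = u + 4 * n)) \<or>
       (v = 4 * n \<and> u = 4 * n + 1 \<or> u = 4 * n \<and> v = 4 * n + 1 \<or>
         v = 2 * (4 * n) \<and> u = 1 \<or> u = 2 * (4 * n) \<and> v = 1))"
      unfolding path [symmetric] path' [symmetric] rungs [symmetric] ends [symmetric]
        Q_verts_eq Q_edges_def by blast
    also have "\<dots> \<longleftrightarrow> u \<in> ?R"
    proof -
      consider "v = 1" | "1 < v" "v < 4 * n" | "v = 4 * n" | "v = 4 * n + 1"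
        | "4 * n + 1 < v" "v < 2 * (4 * n)" | "v = 2 * (4 * n)"
        using v by fastforce
      then show ?thesis
        using assms(1) by cases (cases "rung v"; auto)+
    qed
    finally show ?thesis .
  qed
  then show ?thesis by blast
qed

text \<open>
  The extension of a function on \<open>{1..m}\<close> to \<open>{1..2m}\<close> that is multiplied by \<open>\<epsilon>\<close> under the shift by
  \<open>m\<close>. For \<open>\<epsilon> = 1\<close> and \<open>\<epsilon> = -1\<close> these are the even and the odd functions on the graph.
\<close>
definition lift :: "real \<Rightarrow> nat \<Rightarrow> (nat \<Rightarrow> real) \<Rightarrow> nat \<Rightarrow> real" where
  "lift \<epsilon> m g v = (if v \<le> m then g v else \<epsilon> * g (v - m))"

lemma lift_cong:
  assumes "v \<in> {1..2 * m}" and "\<And>k. k \<in> {1..m} \<Longrightarrow> f k = g k"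
  shows "lift \<epsilon> m f v = lift \<epsilon> m g v"
proof (cases "v \<le> m")
  case False
  then have "v - m \<in> {1..m}" using assms(1) by auto
  with False show ?thesis by (simp add: lift_def assms(2))
qed (use assms in \<open>simp add: lift_def\<close>)

text \<open>
  The values of \<open>g\<close> at \<open>0\<close> and at \<open>4n + 1\<close> take the place of the neighbours across the junctions of
  the two halves, which is why they have to fit the sign \<open>\<epsilon>\<close>. A rung joins the values \<open>x\<close> and
  \<open>\<epsilon> x\<close>, so it contributes \<open>(1 - \<epsilon>) x\<close>.
\<close>
lemma laplacian_lift:
  assumes "n \<ge> 1" and v: "v \<in> {1..2 * (4 * n)}"
    and \<epsilon>: "\<epsilon> * \<epsilon> = 1"
    and ends: "g (4 * n) = \<epsilon> * g 0" "g (4 * n + 1) = \<epsilon> * g 1"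
  shows "laplacian (Q_verts n) (Q_edges n) (lift \<epsilon> (4 * n) g) v =
    lift \<epsilon> (4 * n)
      (\<lambda>k. (2 + of_bool (rung k) * (1 - \<epsilon>)) * g k - g (k - 1) - g (k + 1)) v"
proof -
  define m where "m = 4 * n"
  have m: "m \<ge> 4" "v \<ge> 1" "v \<le> 2 * m"
    using assms by (auto simp: m_def)
  have rung_shift: "rung (v - m) = rung v" if "m < v"
  proof -
    have "v mod 4 = (v - m + 4 * n) mod 4"
      using that by (simp add: m_def)
    then show ?thesis by (simp add: rung_def)
  qed
  have \<epsilon>2: "\<epsilon> * (\<epsilon> * x) = x" for x
    using \<epsilon> by (simp add: mult.assoc [symmetric])
  let ?f = "lift \<epsilon> m g"
  let ?prev = "if v = 1 then 2 * m else v - 1"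
  let ?next = "if v = 2 * m then 1 else v + 1"
  let ?anti = "if v \<le> m then v + m else v - m"
  have prev: "?f ?prev = lift \<epsilon> m (\<lambda>k. g (k - 1)) v"
  proof -
    consider "v = 1" | "v = m + 1" | "v \<noteq> 1" "v \<noteq> m + 1" by blast
    then show ?thesis
      using m ends by cases (auto simp: lift_def m_def [symmetric] \<epsilon>2)
  qed
  have "next": "?f ?next = lift \<epsilon> m (\<lambda>k. g (k + 1)) v"
  proof -
    consider "v = m" | "v = 2 * m" | "v \<noteq> m" "v \<noteq> 2 * m" by blast
    then show ?thesis
      using m ends by cases (auto simp: lift_def m_def [symmetric] \<epsilon>2 Suc_diff_le)
  qed
  have anti: "?f ?anti = \<epsilon> * ?f v"
    using m by (auto simp: lift_def \<epsilon>2)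
  have "laplacian (Q_verts n) (Q_edges n) ?f v =
      (\<Sum>u\<in>{?prev, ?next} \<union> (if rung v then {?anti} else {}). ?f v - ?f u)"
    unfolding laplacian_def m_def using Q_neighbours [OF assms(1) v] by simp
  also have "\<dots> = (?f v - ?f ?prev) + (?f v - ?f ?next) + of_bool (rung v) * (?f v - ?f ?anti)"
  proof -
    have "?prev \<noteq> ?next" "?anti \<noteq> ?prev" "?anti \<noteq> ?next"
      using m by auto
    then show ?thesis by (simp add: insert_commute)
  qed
  also have "\<dots> = lift \<epsilon> m
      (\<lambda>k. (2 + of_bool (rung k) * (1 - \<epsilon>)) * g k - g (k - 1) - g (k + 1)) v"
    unfolding prev "next" anti using rung_shift
    by (cases "v \<le> m"; cases "rung v") (auto simp: lift_def algebra_simps)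
  finally show ?thesis by (simp add: m_def)
qed

lemma sum_split_shift:
  fixes f :: "nat \<Rightarrow> real"
  shows "(\<Sum>k = 1..a + b. f k) = (\<Sum>k = 1..a. f k) + (\<Sum>k = 1..b. f (k + a))"
  using sum.ub_add_nat [of 1 a f b] sum.shift_bounds_cl_nat_ivl [of f 1 a b]
  by (simp add: add.commute)

lemma sum_halves:
  fixes f :: "nat \<Rightarrow> real"
  shows "(\<Sum>v = 1..2 * m. f v) = (\<Sum>k = 1..m. f k + f (k + m))"
  using sum_split_shift [of f m m] by (simp add: mult_2 sum.distrib)

section \<open>The periodic Green function\<close>

text \<open>
  With \<open>d = \<bar>k - l\<bar>\<close>, the function \<open>- d (m - d) / (2m)\<close> has second difference \<open>1/m\<close> away from
  \<open>d = 0\<close> and is invariant under \<open>d \<mapsto> m - d\<close>, so it descends to the cycle. The additive constant is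
  chosen to make the diagonal vanish.
\<close>
definition cycle_green :: "nat \<Rightarrow> nat \<Rightarrow> nat \<Rightarrow> real" where
  "cycle_green m k l = - (\<bar>real k - real l\<bar> * (real m - \<bar>real k - real l\<bar>)) / (2 * real m)"

lemma cycle_green_periodic:
  assumes "l \<in> {1..m}"
  shows "cycle_green m m l = cycle_green m 0 l" "cycle_green m (m + 1) l = cycle_green m 1 l"
  using assms by (auto simp: cycle_green_def algebra_simps)

lemma cycle_green_laplacian:
  assumes "k \<in> {1..m}" "l \<in> {1..m}"
  shows "2 * cycle_green m k l - cycle_green m (k - 1) l - cycle_green m (k + 1) l
       = of_bool (k = l) - 1 / real m"
proof -
  have k: "real (k - 1) = real k - 1" and m: "real m > 0" using assms by auto
  consider "k = l" | "k < l" | "l < k" by linarith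
  then show ?thesis
  proof cases
    case 1
    then show ?thesis unfolding cycle_green_def k using m by (simp add: field_simps)
  next
    case 2
    then have "\<bar>real k - real l\<bar> = real l - real k" "\<bar>real k - 1 - real l\<bar> = real l - real k + 1"
      "\<bar>real (k + 1) - real l\<bar> = real l - real k - 1" by auto
    with m 2 show ?thesis unfolding cycle_green_def k by (simp add: field_simps)
  next
    case 3
    then have "\<bar>real k - real l\<bar> = real k - real l" "\<bar>real k - 1 - real l\<bar> = real k - 1 - real l"
      "\<bar>real (k + 1) - real l\<bar> = real k + 1 - real l" by auto
    with m 3 show ?thesis unfolding cycle_green_def k by (simp add: field_simps)
  qed
qed

text \<open>
  The sum is split at \<open>l\<close>, and each part is a power sum, evaluated by induction on the number of its
  terms. For the induction this number and the cycle length have to be independent, hence \<open>c\<close> below.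
\<close>
lemma sum_cycle_distances:
  assumes "l \<in> {1..m}"
  shows "(\<Sum>k = 1..m. \<bar>real k - real l\<bar> * (real m - \<bar>real k - real l\<bar>))
       = real m * (real m ^ 2 - 1) / 6"
proof -
  have left: "(\<Sum>k = 1..a. (real l - real k) * (c - (real l - real k)))
     = real a * (real l * (c - real l)) + real a * (real a + 1) / 2 * (2 * real l - c)
       - real a * (real a + 1) * (2 * real a + 1) / 6" for a c
    by (induction a) (auto simp: field_simps)
  have right: "(\<Sum>k = 1..b. real k * (c - real k))
     = c * real b * (real b + 1) / 2 - real b * (real b + 1) * (2 * real b + 1) / 6" for b c
    by (induction b) (auto simp: field_simps)
  obtain b where b: "m = l + b" using assms le_Suc_ex by auto
  have "(\<Sum>k = 1..m. \<bar>real k - real l\<bar> * (real m - \<bar>real k - real l\<bar>))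
     = (\<Sum>k = 1..l. \<bar>real k - real l\<bar> * (real m - \<bar>real k - real l\<bar>))
     + (\<Sum>k = 1..b. \<bar>real (k + l) - real l\<bar> * (real m - \<bar>real (k + l) - real l\<bar>))"
    unfolding b by (rule sum_split_shift)
  also have "\<dots> = (\<Sum>k = 1..l. (real l - real k) * (real m - (real l - real k)))
     + (\<Sum>k = 1..b. real k * (real m - real k))"
    by (intro arg_cong2 [of _ _ _ _ "(+)"] sum.cong refl) auto
  also have "\<dots> = real m * (real m ^ 2 - 1) / 6"
    unfolding left right b by (simp add: field_simps power2_eq_square)
  finally show ?thesis .
qed

lemma sum_cycle_green:
  assumes "m \<ge> 1"
  shows "(\<Sum>k = 1..m. \<Sum>l = 1..m. cycle_green m k l) = - real m * (real m ^ 2 - 1) / 12"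
proof -
  have "(\<Sum>k = 1..m. \<Sum>l = 1..m. cycle_green m k l)
      = (\<Sum>l = 1..m. - (\<Sum>k = 1..m. \<bar>real k - real l\<bar> * (real m - \<bar>real k - real l\<bar>)) / (2 * real m))"
    by (subst sum.swap) (simp add: cycle_green_def sum_divide_distrib sum_negf)
  also have "\<dots> = (\<Sum>l = 1..m. - (real m ^ 2 - 1) / 12)"
    using assms by (intro sum.cong refl) (subst sum_cycle_distances, auto simp: field_simps)
  finally show ?thesis by (simp add: algebra_simps)
qed

section \<open>The antiperiodic Green function\<close>

lemma wronskian_constant:
  fixes u v p :: "nat \<Rightarrow> real"
  assumes "\<And>k. 1 \<le> k \<Longrightarrow> u (k - 1) + u (k + 1) = p k * u k"
    and "\<And>k. 1 \<le> k \<Longrightarrow> v (k - 1) + v (k + 1) = p k * v k"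
  shows "u k * v (k + 1) - u (k + 1) * v k = u 0 * v 1 - u 1 * v 0"
proof (induction k)
  case (Suc k)
  have step: "u (k + 2) = p (k + 1) * u (k + 1) - u k" "v (k + 2) = p (k + 1) * v (k + 1) - v k"
    using assms [of "k + 1"] by (simp_all add: algebra_simps)
  have "u (k + 1) * v (k + 2) - u (k + 2) * v (k + 1) = u k * v (k + 1) - u (k + 1) * v k"
    unfolding step by (simp add: algebra_simps)
  with Suc show ?case by simp
qed simp

text \<open>
  Let \<open>u\<close> and \<open>v\<close> be multiplied by \<open>t\<close> and \<open>1/t\<close> under the shift by \<open>m\<close>, where \<open>\<bar>t\<bar> < 1\<close>. For
  \<open>l \<le> k \<le> l + m\<close> the alternating sum over the translates of \<open>u(max(k,l)) v(min(k,l))\<close>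
  splits into two geometric series, according to which argument is the larger one. They add up to
  \<open>u(k) v(l) / (1 + t)\<close> and \<open>- t v(k) u(l) / (1 + t)\<close>. Dividing by the Wronskian normalises the jump
  at \<open>k = l\<close>.
\<close>
definition twisted_green ::
    "(nat \<Rightarrow> real) \<Rightarrow> (nat \<Rightarrow> real) \<Rightarrow> real \<Rightarrow> nat \<Rightarrow> nat \<Rightarrow> real" where
  "twisted_green u v t k l =
     (u (max k l) * v (min k l) - t * (v (max k l) * u (min k l))) /
     ((u 0 * v 1 - u 1 * v 0) * (1 + t))"

lemma twisted_green_antiperiodic:
  assumes "l \<in> {1..m}"
    and "u m = t * u 0" "u (m + 1) = t * u 1" "v 0 = t * v m" "v 1 = t * v (m + 1)"
  shows "twisted_green u v t m l = - twisted_green u v t 0 l"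
    and "twisted_green u v t (m + 1) l = - twisted_green u v t 1 l"
proof -
  let ?N = "\<lambda>k. u (max k l) * v (min k l) - t * (v (max k l) * u (min k l))"
  have "?N m = - ?N 0" "?N (m + 1) = - ?N 1"
    using assms by (auto simp: max_def min_def algebra_simps)
  then show "twisted_green u v t m l = - twisted_green u v t 0 l"
    and "twisted_green u v t (m + 1) l = - twisted_green u v t 1 l"
    unfolding twisted_green_def by (simp_all only: minus_divide_left)
qed

text \<open>
  For \<open>k \<noteq> l\<close> all three arguments lie on the same side of \<open>l\<close>, where the function solves the
  homogeneous recurrence in \<open>k\<close>. At \<open>k = l\<close> the two branches differ by the Wronskian.
\<close>
lemma twisted_green_inverse:
  fixes u v p :: "nat \<Rightarrow> real"
  assumes u: "\<And>k. 1 \<le> k \<Longrightarrow> u (k - 1) + u (k + 1) = p k * u k"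
    and v: "\<And>k. 1 \<le> k \<Longrightarrow> v (k - 1) + v (k + 1) = p k * v k"
    and W: "u 0 * v 1 - u 1 * v 0 \<noteq> 0" and t: "1 + t \<noteq> 0"
    and k: "1 \<le> k"
  shows "p k * twisted_green u v t k l - twisted_green u v t (k - 1) l
       - twisted_green u v t (k + 1) l = of_bool (k = l)"
proof -
  define K where "K = (u 0 * v 1 - u 1 * v 0) * (1 + t)"
  have K: "K \<noteq> 0" using W t by (simp add: K_def)
  let ?G = "\<lambda>k l. u (max k l) * v (min k l) - t * (v (max k l) * u (min k l))"
  have um: "u (k - 1) = p k * u k - u (k + 1)" and vm: "v (k - 1) = p k * v k - v (k + 1)"
    using u [OF k] v [OF k] by (simp_all add: algebra_simps)
  have "p k * ?G k l - ?G (k - 1) l - ?G (k + 1) l = K * of_bool (k = l)"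
  proof -
    consider "k = l" | "k < l" | "l < k" by linarith
    then show ?thesis
    proof cases
      case 1
      have "p k * ?G k l - ?G (k - 1) l - ?G (k + 1) l
          = (u k * v (k + 1) - u (k + 1) * v k) * (1 + t)"
      proof -
        have "max k l = k" "min k l = k" "max (k - 1) l = k" "min (k - 1) l = k - 1"
          "max (k + 1) l = k + 1" "min (k + 1) l = k" using 1 by auto
        then show ?thesis by (simp only: um vm) (simp add: algebra_simps)
      qed
      then show ?thesis
        using 1 wronskian_constant [of u p v k, OF u v] by (simp add: K_def)
    next
      case 2
      then have "max k l = l" "min k l = k" "max (k - 1) l = l" "min (k - 1) l = k - 1"
        "max (k + 1) l = l" "min (k + 1) l = k + 1" by auto
      then show ?thesis using 2 by (simp only: um vm) (simp add: algebra_simps)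
    next
      case 3
      then have "max k l = k" "min k l = l" "max (k - 1) l = k - 1" "min (k - 1) l = l"
        "max (k + 1) l = k + 1" "min (k + 1) l = l" by auto
      then show ?thesis using 3 by (simp only: um vm) (simp add: algebra_simps)
    qed
  qed
  moreover have "p k * (x / K) - y / K - z / K = (p k * x - y - z) / K" for x y z
    by (simp add: diff_divide_distrib)
  ultimately show ?thesis
    unfolding twisted_green_def K_def [symmetric] using K by simp
qed

section \<open>Floquet solutions\<close>

text \<open>
  A sequence with initial values \<open>c\<close>, a list of length \<open>4\<close>, that is multiplied by \<open>t\<close> over each
  period of length \<open>4\<close>.
\<close>
definition floquet :: "real \<Rightarrow> real list \<Rightarrow> nat \<Rightarrow> real" where
  "floquet t c k = t ^ (k div 4) * c ! (k mod 4)"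

lemma floquet_shift: "floquet t c (k + 4 * n) = t ^ n * floquet t c k"
  by (simp add: floquet_def power_add)

text \<open>
  By the scaling under shifts it suffices to check the recurrence at \<open>k = 4, 1, 2, 3\<close>. The hypotheses
  are these four cases, in this order; the first is written for \<open>k = 4\<close>, where the values are
  \<open>c3\<close>, \<open>t c0\<close> and \<open>t c1\<close>.
\<close>
lemma floquet_recurrence:
  assumes "1 \<le> k"
    and "4 * (t * c0) - (c3 + t * c1) = 0" "4 * c1 - (c0 + c2) = 0"
    and "2 * c2 - (c1 + c3) = 0" "2 * c3 - (c2 + t * c0) = 0"
  shows "floquet t [c0, c1, c2, c3] (k - 1) + floquet t [c0, c1, c2, c3] (k + 1)
       = (2 + 2 * of_bool (rung k)) * floquet t [c0, c1, c2, c3] k"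
proof -
  let ?f = "floquet t [c0, c1, c2, c3]"
  have f: "?f (i + 4 * q) = t ^ q * ?f i" for i q
    by (rule floquet_shift)
  have vals: "?f 0 = c0" "?f (Suc 0) = c1" "?f 2 = c2" "?f 3 = c3"
    "?f (Suc (Suc 0)) = c2" "?f (Suc (Suc (Suc 0))) = c3" "?f 4 = t * c0" "?f 5 = t * c1"
    by (simp_all add: floquet_def)
  define q r where "q = (k - 1) div 4" and "r = (k - 1) mod 4"
  have k: "k = r + 1 + 4 * q" "k - 1 = r + 4 * q" "k + 1 = r + 2 + 4 * q"
    using assms(1) by (simp_all add: q_def r_def)
  have rung: "rung (i + 4 * q) = rung i" for i
    by (simp add: rung_def)
  have "r < 4" by (simp add: r_def)
  then have "r = 0 \<or> r = 1 \<or> r = 2 \<or> r = 3" by auto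
  then have "?f r + ?f (r + 2) = (2 + 2 * of_bool (rung (r + 1))) * ?f (r + 1)"
    using assms(2-) by (elim disjE) (simp_all add: vals rung_def)
  moreover have "c * x + c * y = b * (c * z)" if "x + y = b * z" for b c x y z :: real
    using that by (metis distrib_left mult.left_commute)
  ultimately show ?thesis
    unfolding k(2,3) unfolding k(1) f rung by blast
qed

lemma sum_blocks_of_four:
  fixes f :: "nat \<Rightarrow> real"
  assumes "\<And>k. f (k + 4) = f k"
  shows "(\<Sum>k = 1..4 * n. f k) = real n * (f 1 + f 2 + f 3 + f 4)"
proof (induction n)
  case (Suc n)
  have shift: "f (i + 4 * n) = f i" for i
  proof (induction n)
    case (Suc n)
    then show ?case using assms [of "i + 4 * n"] by (simp add: algebra_simps)
  qed simp
  have "(\<Sum>k = 1..4 * Suc n. f k)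
      = (\<Sum>k = 1..4 * n. f k) + (f (1 + 4 * n) + f (2 + 4 * n) + f (3 + 4 * n) + f (4 + 4 * n))"
    by (simp add: numeral_eq_Suc)
  then show ?case unfolding shift Suc by (simp add: algebra_simps)
qed simp

section \<open>The Kirchhoff index\<close>

theorem theorem3p2:
  fixes n :: nat and \<mu> \<nu> :: real
  assumes "n \<ge> 1"
    and "\<mu> = 15 + 4 * sqrt 14"
    and "\<nu> = 15 - 4 * sqrt 14"
  shows "kirchhoff_index (Q_verts n) (Q_edges n) =
           (32 * real n ^ 3 - 2 * real n) / 3 +
           36 * real n ^ 2 * sqrt 14 / 7 * ((\<mu> ^ n - \<nu> ^ n) / (\<mu> ^ n + \<nu> ^ n + 2))"
proof -
  define s :: real where "s = sqrt 14"
  have s2: "s * s = 14" by (simp add: s_def)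
  have ss: "s * (s * x) = 14 * x" for x
    by (simp add: s2 mult.assoc [symmetric])
  have \<mu>: "\<mu> = 15 + 4 * s" and \<nu>: "\<nu> = 15 - 4 * s"
    using assms by (simp_all add: s_def)
  have s_pos: "s > 0" by (simp add: s_def)
  have "s \<noteq> 28 / 9"
  proof
    assume "s = 28 / 9"
    with s2 show False by simp
  qed
  have \<mu>\<nu>: "\<mu> * \<nu> = 1"
    by (simp add: \<mu> \<nu> algebra_simps s2)
  have "\<mu> > 0" using s_pos by (simp add: \<mu>)
  with \<mu>\<nu> have "\<nu> > 0" by (metis zero_less_mult_pos zero_less_one)
  define m where "m = 4 * n"
  define t where "t = \<nu> ^ n"
  have t: "t > 0" using \<open>\<nu> > 0\<close> by (simp add: t_def)
  have t\<mu>: "t * \<mu> ^ n = 1"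
    using \<mu>\<nu> by (simp add: t_def mult.commute flip: power_mult_distrib)
  \<comment> \<open>Starting from \<open>u 0 = a\<close> and \<open>u 1 = b\<close>, the recurrence gives \<open>u 4 = 10 b - 3 a\<close>. For this to be
    \<open>\<nu> a\<close>, the ratio of \<open>b\<close> to \<open>a\<close> has to be \<open>(9 - 2 s) / 5\<close>.\<close>
  define u where "u = floquet \<nu> [5, 9 - 2 * s, 31 - 8 * s, 53 - 14 * s]"
  \<comment> \<open>The positions of the rungs are invariant under \<open>k \<mapsto> 5 - k\<close>, and \<open>w\<close> is the
    reflection of \<open>u\<close>, up to a factor.\<close>
  define w where "w = floquet \<mu> [9 - 2 * s, 5, 11 + 2 * s, 17 + 4 * s]"
  define p :: "nat \<Rightarrow> real" where "p = (\<lambda>k. 2 + 2 * of_bool (rung k))"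
  have u: "u (k - 1) + u (k + 1) = p k * u k" if "1 \<le> k" for k
    unfolding u_def p_def by (rule floquet_recurrence [OF that]) (auto simp: \<nu> algebra_simps s2)
  have w: "w (k - 1) + w (k + 1) = p k * w k" if "1 \<le> k" for k
    unfolding w_def p_def by (rule floquet_recurrence [OF that]) (auto simp: \<mu> algebra_simps s2)
  have u_vals: "u 0 = 5" "u 1 = 9 - 2 * s" "u 2 = 31 - 8 * s" "u 3 = 53 - 14 * s" "u 4 = 5 * \<nu>"
    and w_vals: "w 0 = 9 - 2 * s" "w 1 = 5" "w 2 = 11 + 2 * s" "w 3 = 17 + 4 * s"
      "w 4 = (9 - 2 * s) * \<mu>"
    by (simp_all add: u_def w_def floquet_def)
  have u_shift: "u (k + m) = t * u k" and w_shift: "w k = t * w (k + m)" for k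
    using t\<mu> by (simp_all add: u_def w_def floquet_shift m_def t_def flip: mult.assoc)
  have W: "u 0 * w 1 - u 1 * w 0 = 4 * (9 * s - 28)"
    unfolding u_vals w_vals by (simp add: algebra_simps s2)
  have W0: "9 * s - 28 \<noteq> 0"
    using \<open>s \<noteq> 28 / 9\<close> by simp
  define A where "A = twisted_green u w t"
  define C where "C = cycle_green m"
  define G where "G = (\<lambda>v i. (1/2) * (lift 1 m (\<lambda>k. lift 1 m (C k) i) v
     + lift (-1) m (\<lambda>k. lift (-1) m (A k) i) v))"
  have m1: "m \<ge> 1" using assms(1) by (simp add: m_def)
  have card: "card (Q_verts n) = 2 * m" by (simp add: Q_verts_eq m_def)
  have green: "green_function (Q_verts n) (Q_edges n) G"
    unfolding green_function_def
  proof (intro ballI)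
    fix i v assume iv: "i \<in> Q_verts n" "v \<in> Q_verts n"
    then have v: "v \<in> {1..2 * (4 * n)}" by (simp add: Q_verts_eq)
    from iv have iv': "1 \<le> v" "v \<le> 2 * m" "1 \<le> i" "i \<le> 2 * m" by (auto simp: Q_verts_eq m_def)
    \<comment> \<open>The column index \<open>i\<close> enters only through its projection \<open>l\<close> to the cycle and a sign.\<close>
    define l where "l = (if i \<le> m then i else i - m)"
    have l: "l \<in> {1..m}" using iv' by (auto simp: l_def)
    have lift: "lift \<epsilon> m f i = (if i \<le> m then 1 else \<epsilon>) * f l" for \<epsilon> f
      by (simp add: lift_def l_def)
    have A_ends: "A m l = - A 0 l" "A (m + 1) l = - A 1 l"
      unfolding A_def using twisted_green_antiperiodic [OF l, of u t w] u_shift [of 0] u_shift [of 1]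
        w_shift [of 0] w_shift [of 1] by (simp_all add: add.commute)
    note C_ends = cycle_green_periodic [OF l, folded C_def]
    have A_inv: "p k * A k l - A (k - 1) l - A (k + 1) l = of_bool (k = l)" if "1 \<le> k" for k
      unfolding A_def using W W0 t that by (intro twisted_green_inverse u w) auto
    have lapC: "laplacian (Q_verts n) (Q_edges n) (lift 1 m (\<lambda>k. lift 1 m (C k) i)) v
        = lift 1 m (\<lambda>k. 2 * C k l - C (k - 1) l - C (k + 1) l) v"
      using laplacian_lift [OF assms(1) v, of 1 "\<lambda>k. C k l"] C_ends
      by (simp add: lift m_def [symmetric])
    have lapA: "laplacian (Q_verts n) (Q_edges n) (lift (-1) m (\<lambda>k. lift (-1) m (A k) i)) v
        = (if i \<le> m then 1 else - 1) * lift (-1) m (\<lambda>k. p k * A k l - A (k - 1) l - A (k + 1) l) v"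
    proof -
      have "lift (-1) m (\<lambda>k. lift (-1) m (A k) i)
          = (\<lambda>v. (if i \<le> m then 1 else - 1) * lift (-1) m (\<lambda>k. A k l) v)"
        unfolding lift by (auto simp: lift_def)
      then show ?thesis
        using laplacian_lift [OF assms(1) v, of "-1" "\<lambda>k. A k l"] A_ends
        by (simp only: laplacian_scale m_def [symmetric]) (simp add: p_def mult.commute)
    qed
    have lapC': "lift 1 m (\<lambda>k. 2 * C k l - C (k - 1) l - C (k + 1) l) v
        = lift 1 m (\<lambda>k. of_bool (k = l) - 1 / real m) v"
      unfolding C_def using iv' by (intro lift_cong cycle_green_laplacian l) auto
    have lapA': "lift (-1) m (\<lambda>k. p k * A k l - A (k - 1) l - A (k + 1) l) v
        = lift (-1) m (\<lambda>k. of_bool (k = l)) v"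
      using iv' by (intro lift_cong A_inv) auto
    show "laplacian (Q_verts n) (Q_edges n) (\<lambda>v. G v i) v = of_bool (v = i) - 1 / real (card (Q_verts n))"
      unfolding G_def laplacian_scale laplacian_add lapC lapA lapC' lapA'
      using iv' m1 by (auto simp: lift_def l_def card field_simps)
  qed
  have G_trace: "(\<Sum>v\<in>Q_verts n. G v v) = (\<Sum>k = 1..m. A k k)"
    unfolding Q_verts_eq m_def [symmetric] sum_halves
    by (intro sum.cong refl) (auto simp: G_def lift_def C_def cycle_green_def)
  \<comment> \<open>The odd part cancels between the two halves.\<close>
  have G_sum: "(\<Sum>v\<in>Q_verts n. \<Sum>i\<in>Q_verts n. G v i) = - (real m * (real m ^ 2 - 1) / 6)"
  proof -
    have "(\<Sum>v\<in>Q_verts n. \<Sum>i\<in>Q_verts n. G v i) = (\<Sum>k = 1..m. \<Sum>l = 1..m. 2 * C k l)"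
      unfolding Q_verts_eq m_def [symmetric] sum_halves sum.distrib [symmetric]
      by (intro sum.cong refl) (auto simp: G_def lift_def)
    also have "\<dots> = 2 * (\<Sum>k = 1..m. \<Sum>l = 1..m. C k l)"
      by (simp add: sum_distrib_left)
    finally show ?thesis
      unfolding C_def using sum_cycle_green [OF m1] by simp
  qed
  have A_diag: "A k k = (u k * w k) * ((1 - t) / (4 * (9 * s - 28) * (1 + t)))" for k
  proof -
    have "u k * w k - t * (w k * u k) = u k * w k * (1 - t)" by (simp add: algebra_simps)
    then show ?thesis unfolding A_def twisted_green_def W by simp
  qed
  have per: "u (k + 4) * w (k + 4) = u k * w k" for k
    using \<mu>\<nu> floquet_shift [of _ _ k 1] by (simp add: u_def w_def algebra_simps)
  have block: "u 1 * w 1 + u 2 * w 2 + u 3 * w 3 + u 4 * w 4 = 36 * (9 - 2 * s)"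
    unfolding u_vals w_vals \<mu> \<nu> by (simp add: algebra_simps s2 ss)
  have A_trace: "(\<Sum>k = 1..m. A k k) = real n * (9 * s / 14) * ((1 - t) / (1 + t))"
  proof -
    have "(\<Sum>k = 1..m. A k k)
        = real n * (36 * (9 - 2 * s)) * ((1 - t) / (4 * (9 * s - 28) * (1 + t)))"
      unfolding A_diag sum_distrib_right [symmetric] m_def
      by (subst sum_blocks_of_four [of "\<lambda>k. u k * w k", OF per]) (simp only: block)
    also have "\<dots> = real n * (36 * (9 - 2 * s) / (4 * (9 * s - 28))) * ((1 - t) / (1 + t))"
      by simp
    \<comment> \<open>Since \<open>s\<^sup>2 = 14\<close>, multiplying \<open>9 - 2 s\<close> by \<open>14\<close> gives \<open>s (9 s - 28)\<close>.\<close>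
    also have "36 * (9 - 2 * s) / (4 * (9 * s - 28)) = 9 * s / 14"
      using W0 by (simp add: field_simps s2 ss)
    finally show ?thesis .
  qed
  have ratio: "(1 - t) / (1 + t) = (\<mu> ^ n - \<nu> ^ n) / (\<mu> ^ n + \<nu> ^ n + 2)"
  proof -
    have "\<mu> ^ n + t + 2 > 0" using t \<open>\<mu> > 0\<close> by (simp add: add_pos_pos)
    moreover have "(1 - t) * (\<mu> ^ n + t + 2) = (\<mu> ^ n - t) * (1 + t)"
      using t\<mu> by (simp add: algebra_simps)
    ultimately show ?thesis
      using t unfolding t_def [symmetric] by (simp add: frac_eq_eq)
  qed
  have "kirchhoff_index (Q_verts n) (Q_edges n)
      = real (2 * m) * (real n * (9 * s / 14) * ((1 - t) / (1 + t))) + real m * (real m ^ 2 - 1) / 6"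
  proof -
    have "finite (Q_verts n)" by (simp add: Q_verts_eq)
    from kirchhoff_index_eq_green [OF this green] show ?thesis
      unfolding G_trace G_sum A_trace card by simp
  qed
  also have "\<dots> = (32 * real n ^ 3 - 2 * real n) / 3
      + 36 * real n ^ 2 * s / 7 * ((1 - t) / (1 + t))"
  proof -
    have "real (2 * m) * (real n * (9 * s / 14) * R) + real m * (real m ^ 2 - 1) / 6
        = (32 * real n ^ 3 - 2 * real n) / 3 + 36 * real n ^ 2 * s / 7 * R" for R
      by (simp add: m_def field_simps power2_eq_square power3_eq_cube)
    then show ?thesis .
  qed
  finally show ?thesis
    unfolding ratio s_def .
qed

end
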